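(* Let $d\ge 8$ and $n\ge 1$. Let $B^0,\dots,B^{n-1}$ be $n$ vertex-disjoint copies of $K_{d-2}$, the vertices of $B^i$ being labelled $a^i_1,\dots,a^i_{d-2}$, and connect consecutive bays by making $a^i_j$ adjacent to $a^{i-1}_{d-1-j}$ for all $0\le i\le n-1$ and $1\le j\le \lceil (d-2)/2\rceil$, superscripts taken mod $n$. Let $P_d$ be the graph obtained from $K_{d+1}$ by deleting the edges of three pairwise vertex-disjoint paths of length 2 and then deleting a maximum matching on the $d-8$ vertices not on these paths (so exactly three vertices of $P_d$ have degree $d-2$). Let $G^n_d$ be obtained by adding pairwise vertex-disjoint copies of $P_d$, where for each copy one edge is added from each of its three vertices of degree $d-2$ to a vertex of a single bay $B^i$ (the same bay for all three edges), there are no edges between distinct copies, and enough copies are added so that every vertex of every $B^i$ has degree at least $d-1$. Then $G^n_d$ has minimum degree $d-1$ and has no immersion of $K_d$.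
   Context: All graphs are simple. A graph $H$ is immersed in a graph $G$ if there is an injection $\phi:V(H)\to V(G)$ and an assignment to each edge $uv\in E(H)$ of a path in $G$ between $\phi(u)$ and $\phi(v)$ with paths of distinct edges pairwise edge-disjoint. *)

theory Defs
  imports Complex_Main "HOL-Library.Ramsey"
begin

text \<open>Simple graphs: an edge is a two-element set of vertices, i.e. an element of
  \<^term>\<open>[V]\<^bsup>2\<^esup>\<close>.\<close>

record 'a graph =
  verts :: "'a set"
  edges :: "'a set set"

definition complete_graph :: "'a set \<Rightarrow> 'a graph" where
  "complete_graph V = \<lparr>verts = V, edges = [V]\<^bsup>2\<^esup>\<rparr>"

definition degree :: "'a graph \<Rightarrow> 'a \<Rightarrow> nat" where
  "degree G v = card {e \<in> edges G. v \<in> e}"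

definition min_degree :: "'a graph \<Rightarrow> nat" where
  "min_degree G = Min (degree G ` verts G)"

fun path_edges :: "'a list \<Rightarrow> 'a set set" where
  "path_edges (x # y # zs) = insert {x, y} (path_edges (y # zs))"
| "path_edges _ = {}"

text \<open>A path is represented by its list of vertices; its length is the number of its edges,
  that is, one less than the length of the list.\<close>

definition is_path :: "'a graph \<Rightarrow> 'a list \<Rightarrow> bool" where
  "is_path G p \<longleftrightarrow>
     p \<noteq> [] \<and> distinct p \<and> set p \<subseteq> verts G \<and> path_edges p \<subseteq> edges G"

text \<open>The end points of the path assigned to an edge are compared as a set, since edges are
  unordered while lists are directed. Paths may pass through images of other vertices.\<close>

definition immersed :: "'a graph \<Rightarrow> 'b graph \<Rightarrow> bool" where
  "immersed H G \<longleftrightarrow>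
     (\<exists>\<phi> P. inj_on \<phi> (verts H) \<and> \<phi> ` verts H \<subseteq> verts G \<and>
        (\<forall>e \<in> edges H. is_path G (P e) \<and> {hd (P e), last (P e)} = \<phi> ` e) \<and>
        (\<forall>e \<in> edges H. \<forall>f \<in> edges H. e \<noteq> f \<longrightarrow>
            path_edges (P e) \<inter> path_edges (P f) = {}))"

definition matching :: "'a graph \<Rightarrow> 'a set set \<Rightarrow> bool" where
  "matching G M \<longleftrightarrow> M \<subseteq> edges G \<and> pairwise disjnt M"

definition maximum_matching :: "'a graph \<Rightarrow> 'a set set \<Rightarrow> bool" where
  "maximum_matching G M \<longleftrightarrow>
     matching G M \<and> (\<forall>M'. matching G M' \<longrightarrow> card M' \<le> card M)"

text \<open>\<open>is_P d Q\<close>: \<open>Q\<close> is a copy of the graph \<open>P\<^sub>d\<close>.\<close>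

definition is_P :: "nat \<Rightarrow> 'a graph \<Rightarrow> bool" where
  "is_P d Q \<longleftrightarrow>
     (\<exists>V p q r M.
        finite V \<and> card V = d + 1 \<and>
        is_path (complete_graph V) p \<and> length p = 3 \<and>
        is_path (complete_graph V) q \<and> length q = 3 \<and>
        is_path (complete_graph V) r \<and> length r = 3 \<and>
        set p \<inter> set q = {} \<and> set p \<inter> set r = {} \<and> set q \<inter> set r = {} \<and>
        maximum_matching (complete_graph (V - (set p \<union> set q \<union> set r))) M \<and>
        Q = \<lparr>verts = V,
             edges = [V]\<^bsup>2\<^esup> - (path_edges p \<union> path_edges q \<union> path_edges r) - M\<rparr>)"

definition bay :: "nat \<Rightarrow> (nat \<Rightarrow> nat \<Rightarrow> 'a) \<Rightarrow> nat \<Rightarrow> 'a set" where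
  "bay d a i = a i ` {1..d - 2}"

text \<open>Here \<open>(i + n - 1) mod n\<close> is \<open>i - 1\<close> modulo \<open>n\<close>. Graphs being simple, the pair that
  degenerates to a single vertex (this only happens for \<open>n = 1\<close> and \<open>d\<close> odd) gives no edge.\<close>

definition bay_connections :: "nat \<Rightarrow> nat \<Rightarrow> (nat \<Rightarrow> nat \<Rightarrow> 'a) \<Rightarrow> 'a set set" where
  "bay_connections d n a =
     {{a i j, a ((i + n - 1) mod n) (d - 1 - j)} | i j.
        i < n \<and> 1 \<le> j \<and> j \<le> nat \<lceil>real (d - 2) / 2\<rceil> \<and>
        a i j \<noteq> a ((i + n - 1) mod n) (d - 1 - j)}"

text \<open>\<open>is_G d n G\<close>: \<open>G\<close> arises from the construction of \<open>G\<^sub>d\<^sup>n\<close>. The vertex \<open>a i j\<close> is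
  \<open>a\<^sup>i\<^sub>j\<close>, \<open>\<Q>\<close> is the set of copies of \<open>P\<^sub>d\<close>, and a vertex \<open>v\<close> of degree \<open>d - 2\<close> in its copy is
  joined to the bay vertex \<open>t v\<close>. The three bay vertices chosen for a copy need not be distinct.\<close>

definition is_G :: "nat \<Rightarrow> nat \<Rightarrow> 'a graph \<Rightarrow> bool" where
  "is_G d n G \<longleftrightarrow>
     (\<exists>a \<Q> t.
        inj_on (\<lambda>(i, j). a i j) ({..<n} \<times> {1..d - 2}) \<and>
        finite \<Q> \<and> (\<forall>Q \<in> \<Q>. is_P d Q) \<and>
        pairwise (\<lambda>Q R. disjnt (verts Q) (verts R)) \<Q> \<and>
        (\<forall>Q \<in> \<Q>. \<forall>i < n. disjnt (verts Q) (bay d a i)) \<and>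
        (\<forall>Q \<in> \<Q>. \<exists>i < n. \<forall>v \<in> verts Q. degree Q v = d - 2 \<longrightarrow> t v \<in> bay d a i) \<and>
        verts G = (\<Union>i<n. bay d a i) \<union> (\<Union>Q \<in> \<Q>. verts Q) \<and>
        edges G = (\<Union>i<n. [bay d a i]\<^bsup>2\<^esup>) \<union> bay_connections d n a \<union> (\<Union>Q \<in> \<Q>. edges Q) \<union>
          {{v, t v} | Q v. Q \<in> \<Q> \<and> v \<in> verts Q \<and> degree Q v = d - 2} \<and>
        (\<forall>i < n. \<forall>v \<in> bay d a i. degree G v \<ge> d - 1))"

end

theory Submission
  imports Defs
begin

text \<open>If a set of vertices contains \<open>k\<close> branch vertices of an immersed \<open>K\<^sub>d\<close>, then
  \<open>k (d - k)\<close> edges leave it. A copy of \<open>P\<^sub>d\<close> is left by only three edges, so it contains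
  either no branch vertex or all of them; a cyclic interval of bays, together with the copies
  attached to it, is left by at most \<open>d - 1 < 2 (d - 2)\<close> edges, so it never contains between
  \<open>2\<close> and \<open>d - 2\<close> branch vertices. The latter excludes that all branch vertices lie in the bays:
  add the bays one at a time until at least two branch vertices are collected; if the last bay
  brings at least two (it has at most \<open>d - 2\<close>) consider this bay alone, otherwise the interval
  contains exactly two.

  If all branch vertices lie in one copy of \<open>P\<^sub>d\<close>, every path crosses its boundary an even number of
  times, so one of the three attaching edges, say at \<open>m\<close>, is unused. Then \<open>m\<close> has only
  \<open>d - 2\<close> usable edges, hence is the unique vertex of the copy that is not a branch vertex. All
  degrees in the copy are at most \<open>d\<close>, so no path runs through a further branch vertex. A second
  vertex \<open>m'\<close> of degree \<open>d - 2\<close> in \<open>P\<^sub>d\<close> has two non-neighbours, and the paths from \<open>m'\<close> to both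
  of them must start with the edge \<open>m' m\<close>.\<close>

section \<open>Paths and cuts\<close>

text \<open>Ranges over all sets instead of the edges of one graph, so that it can be intersected
  with the edges of a path, of \<open>G\<close>, or with \<open>used\<close>.\<close>

definition crossing :: "'a set \<Rightarrow> 'a set set" where
  "crossing S = {e. e \<inter> S \<noteq> {} \<and> \<not> e \<subseteq> S}"

lemma finite_path_edges [simp]: "finite (path_edges p)"
  by (induction p rule: path_edges.induct) auto

lemma Union_path_edges_subset: "\<Union> (path_edges p) \<subseteq> set p"
  by (induction p rule: path_edges.induct) auto

lemma path_edges_Cons_notin:
  assumes "distinct (x # p)" "e \<in> path_edges p"
  shows "x \<notin> e"
  using assms Union_path_edges_subset[of p] by auto

text \<open>Every crossing edge switches sides. Distinctness ensures that the first edge does not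
  recur, so that the cardinality of the edge set counts the switches.\<close>

lemma even_card_path_crossing:
  assumes "p \<noteq> []" "distinct p"
  shows "even (card (path_edges p \<inter> crossing S)) \<longleftrightarrow> (hd p \<in> S \<longleftrightarrow> last p \<in> S)"
  using assms
proof (induction p rule: path_edges.induct)
  case (1 x y zs)
  have notin: "{x, y} \<notin> path_edges (y # zs)"
    using path_edges_Cons_notin[OF 1(3)] by auto
  have IH: "even (card (path_edges (y # zs) \<inter> crossing S)) \<longleftrightarrow> (y \<in> S \<longleftrightarrow> last (y # zs) \<in> S)"
    using 1 by simp
  show ?case
  proof (cases "{x, y} \<in> crossing S")
    case True
    then have "card (path_edges (x # y # zs) \<inter> crossing S)
        = Suc (card (path_edges (y # zs) \<inter> crossing S))"
      using notin by simp
    moreover have "x \<in> S \<longleftrightarrow> y \<notin> S"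
      using True by (auto simp: crossing_def)
    ultimately show ?thesis
      using IH by (auto simp del: path_edges.simps)
  next
    case False
    moreover have "x \<in> S \<longleftrightarrow> y \<in> S"
      using False by (auto simp: crossing_def)
    ultimately show ?thesis
      using IH by simp
  qed
qed auto

lemma card_path_edges_end:
  assumes "p \<noteq> []" "distinct p" "hd p \<noteq> last p" "v = hd p \<or> v = last p"
  shows "card {e \<in> path_edges p. v \<in> e} = 1"
  using assms
proof (induction p rule: path_edges.induct)
  case (1 x y zs)
  show ?case
  proof (cases "v = x")
    case True
    then have "{e \<in> path_edges (x # y # zs). v \<in> e} = {{x, y}}"
      using path_edges_Cons_notin[OF 1(3)] by auto
    then show ?thesis by simp
  next
    case False
    then have v: "v = last (y # zs)"
      using 1(5) by auto
    show ?thesis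
    proof (cases "zs = []")
      case True
      then have "{e \<in> path_edges (x # y # zs). v \<in> e} = {{x, y}}"
        using v by auto
      then show ?thesis by simp
    next
      case zs: False
      then have "v \<noteq> y"
        using v 1(3) by auto
      then have "{e \<in> path_edges (x # y # zs). v \<in> e} = {e \<in> path_edges (y # zs). v \<in> e}"
        using False by auto
      moreover have "card {e \<in> path_edges (y # zs). v \<in> e} = 1"
        using 1 v \<open>v \<noteq> y\<close> by auto
      ultimately show ?thesis by simp
    qed
  qed
qed auto

lemma card_path_edges_interior:
  assumes "distinct p" "v \<in> set p" "v \<noteq> hd p" "v \<noteq> last p"
  shows "card {e \<in> path_edges p. v \<in> e} = 2"
  using assms
proof (induction p rule: path_edges.induct)
  case (1 x y zs)
  show ?case
  \<comment> \<open>The vertex \<open>y\<close> is inner in the whole path but an end of its tail;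
    the tail contributes one edge at \<open>y\<close> and \<open>{x, y}\<close> is the
    second.\<close>
  proof (cases "v = y")
    case True
    then have "zs \<noteq> []"
      using 1(5) by auto
    then have "last zs \<noteq> y"
      using 1(2) by auto
    then have "card {e \<in> path_edges (y # zs). v \<in> e} = 1"
      using card_path_edges_end[of "y # zs" v] 1(2) True \<open>zs \<noteq> []\<close> by auto
    moreover have "{e \<in> path_edges (x # y # zs). v \<in> e}
        = insert {x, y} {e \<in> path_edges (y # zs). v \<in> e}"
      using True by auto
    moreover have "{x, y} \<notin> path_edges (y # zs)"
      using path_edges_Cons_notin[OF 1(2)] by auto
    ultimately show ?thesis by simp
  next
    case False
    then have "{e \<in> path_edges (x # y # zs). v \<in> e} = {e \<in> path_edges (y # zs). v \<in> e}"
      using 1 by auto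
    then show ?thesis
      using 1 False by auto
  qed
qed auto

lemma card_incident_nsets:
  assumes "finite V" "v \<in> V"
  shows "card {e \<in> [V]\<^bsup>2\<^esup>. v \<in> e} = card V - 1"
proof -
  have "{e \<in> [V]\<^bsup>2\<^esup>. v \<in> e} = (\<lambda>w. {v, w}) ` (V - {v})"
    using assms by (fastforce simp: nsets_def card_2_iff)
  moreover have "inj_on (\<lambda>w. {v, w}) (V - {v})"
    by (auto simp: inj_on_def doubleton_eq_iff)
  ultimately show ?thesis
    using assms by (simp add: card_image)
qed

section \<open>Immersions of complete graphs\<close>

locale clique_immersion =
  fixes G :: "'a graph" and U :: "'b set" and \<phi> :: "'b \<Rightarrow> 'a" and P :: "'b set \<Rightarrow> 'a list"
  assumes finite_U: "finite U"
    and inj: "inj_on \<phi> U"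
    and in_verts: "\<phi> ` U \<subseteq> verts G"
    and path: "f \<in> [U]\<^bsup>2\<^esup> \<Longrightarrow> is_path G (P f)"
    and ends: "f \<in> [U]\<^bsup>2\<^esup> \<Longrightarrow> {hd (P f), last (P f)} = \<phi> ` f"
    and disj: "f \<in> [U]\<^bsup>2\<^esup> \<Longrightarrow> g \<in> [U]\<^bsup>2\<^esup> \<Longrightarrow> f \<noteq> g \<Longrightarrow> path_edges (P f) \<inter> path_edges (P g) = {}"
begin

definition used :: "'a set set" where
  "used = (\<Union>f \<in> [U]\<^bsup>2\<^esup>. path_edges (P f))"

lemma finite_pairs [simp]: "finite ([U]\<^bsup>2\<^esup>)"
  using finite_U by (simp add: finite_imp_finite_nsets)

lemma used_subset: "used \<subseteq> edges G"
  using path by (auto simp: used_def is_path_def)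

lemma ends_cases:
  assumes "{u, w} \<in> [U]\<^bsup>2\<^esup>"
  shows "hd (P {u, w}) = \<phi> u \<and> last (P {u, w}) = \<phi> w
       \<or> hd (P {u, w}) = \<phi> w \<and> last (P {u, w}) = \<phi> u"
  using ends[OF assms] by (auto simp: doubleton_eq_iff)

text \<open>Edge-disjointness becomes additivity here: used edges can be counted path by
  path.\<close>

lemma card_used_Collect:
  "card {e \<in> used. R e} = (\<Sum>f \<in> [U]\<^bsup>2\<^esup>. card {e \<in> path_edges (P f). R e})"
proof -
  have "{e \<in> used. R e} = (\<Union>f \<in> [U]\<^bsup>2\<^esup>. {e \<in> path_edges (P f). R e})"
    by (auto simp: used_def)
  moreover have "\<forall>f \<in> [U]\<^bsup>2\<^esup>. \<forall>g \<in> [U]\<^bsup>2\<^esup>. f \<noteq> g \<longrightarrow>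
      {e \<in> path_edges (P f). R e} \<inter> {e \<in> path_edges (P g). R e} = {}"
    using disj by blast
  ultimately show ?thesis
    using card_UN_disjoint[of "[U]\<^bsup>2\<^esup>" "\<lambda>f. {e \<in> path_edges (P f). R e}"] by simp
qed

lemma pairI: "u \<in> U \<Longrightarrow> w \<in> U \<Longrightarrow> u \<noteq> w \<Longrightarrow> {u, w} \<in> [U]\<^bsup>2\<^esup>"
  by (auto simp: nsets_def)

text \<open>A path joining branch vertices on opposite sides crosses an odd number of times, hence
  at least once, and distinct paths use distinct crossing edges. The superset \<open>C\<close>
  allows a cut to be replaced by an explicit set that is easier to count.\<close>

lemma cut_bound:
  assumes "finite C" "edges G \<inter> crossing S \<subseteq> C"
  shows "card {u \<in> U. \<phi> u \<in> S} * card {u \<in> U. \<phi> u \<notin> S} \<le> card C"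
proof -
  let ?A = "{u \<in> U. \<phi> u \<in> S}" and ?B = "{u \<in> U. \<phi> u \<notin> S}"
  let ?F = "(\<lambda>(u, w). {u, w}) ` (?A \<times> ?B)"
  have "inj_on (\<lambda>(u, w). {u, w}) (?A \<times> ?B)"
    by (auto simp: inj_on_def doubleton_eq_iff)
  then have card_F: "card ?F = card ?A * card ?B"
    by (simp add: card_image card_cartesian_product)
  have F: "?F \<subseteq> [U]\<^bsup>2\<^esup>"
    using pairI by auto
  have one: "1 \<le> card {e \<in> path_edges (P f). e \<in> crossing S}" if "f \<in> ?F" for f
  proof -
    obtain u w where uw: "u \<in> ?A" "w \<in> ?B" "f = {u, w}"
      using \<open>f \<in> ?F\<close> by blast
    then have "{u, w} \<in> [U]\<^bsup>2\<^esup>"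
      using that F by auto
    then have "odd (card (path_edges (P f) \<inter> crossing S))"
      using even_card_path_crossing[of "P f" S] path[of f] ends_cases[of u w] uw
      by (auto simp: is_path_def)
    then have "1 \<le> card (path_edges (P f) \<inter> crossing S)"
      by (metis One_nat_def Suc_leI odd_pos)
    then show ?thesis
      by (simp add: Int_def)
  qed
  have "card ?A * card ?B = (\<Sum>f \<in> ?F. 1)"
    using card_F by simp
  also have "\<dots> \<le> (\<Sum>f \<in> ?F. card {e \<in> path_edges (P f). e \<in> crossing S})"
    using one by (rule sum_mono)
  also have "\<dots> \<le> (\<Sum>f \<in> [U]\<^bsup>2\<^esup>. card {e \<in> path_edges (P f). e \<in> crossing S})"
    using F by (intro sum_mono2) auto
  also have "\<dots> = card {e \<in> used. e \<in> crossing S}"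
    by (simp add: card_used_Collect)
  also have "\<dots> \<le> card C"
    using assms used_subset by (intro card_mono) auto
  finally show ?thesis .
qed

lemma card_path_end:
  assumes "u \<in> U" "f \<in> [U]\<^bsup>2\<^esup>" "u \<in> f"
  shows "card {e \<in> path_edges (P f). \<phi> u \<in> e} = 1"
proof -
  obtain w where w: "f = {u, w}" "u \<noteq> w" "w \<in> U"
    using assms by (fastforce simp: nsets_def card_2_iff)
  then have "\<phi> u \<noteq> \<phi> w"
    using inj assms by (auto simp: inj_on_def)
  then show ?thesis
    using card_path_edges_end[of "P f" "\<phi> u"] path[of f] ends_cases[of u w] assms w
    by (auto simp: is_path_def)
qed

text \<open>Each of the \<open>card U - 1\<close> paths ending at \<open>\<phi> u\<close> takes its
  own edge there.\<close>

lemma used_degree: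
  assumes "u \<in> U"
  shows "card U - 1 \<le> card {e \<in> used. \<phi> u \<in> e}"
proof -
  have "card U - 1 = (\<Sum>f \<in> {f \<in> [U]\<^bsup>2\<^esup>. u \<in> f}. 1)"
    using card_incident_nsets[OF finite_U assms] by simp
  also have "\<dots> = (\<Sum>f \<in> {f \<in> [U]\<^bsup>2\<^esup>. u \<in> f}. card {e \<in> path_edges (P f). \<phi> u \<in> e})"
    using card_path_end assms by (intro sum.cong) auto
  also have "\<dots> \<le> (\<Sum>f \<in> [U]\<^bsup>2\<^esup>. card {e \<in> path_edges (P f). \<phi> u \<in> e})"
    by (intro sum_mono2) auto
  finally show ?thesis
    by (simp add: card_used_Collect)
qed

text \<open>The \<open>card U - 1\<close> paths ending at \<open>\<phi> u\<close> take one edge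
  each, and the path running through it takes two more.\<close>

lemma degree_ge_of_passing:
  assumes u: "u \<in> U" and g: "g \<in> [U]\<^bsup>2\<^esup>" "u \<notin> g" "\<phi> u \<in> set (P g)"
    and fin: "finite (edges G)"
  shows "card U + 1 \<le> degree G (\<phi> u)"
proof -
  have "card U \<ge> 1"
    using u finite_U by (metis One_nat_def Suc_leI card_gt_0_iff empty_iff)
  have "\<phi> u \<notin> \<phi> ` g"
    using u g inj by (auto simp: nsets_def inj_on_def)
  then have "\<phi> u \<noteq> hd (P g)" "\<phi> u \<noteq> last (P g)"
    using ends[OF g(1)] by auto
  then have two: "card {e \<in> path_edges (P g). \<phi> u \<in> e} = 2"
    using card_path_edges_interior path[OF g(1)] g by (auto simp: is_path_def)
  have "card U + 1 = (\<Sum>f \<in> {f \<in> [U]\<^bsup>2\<^esup>. u \<in> f}. 1) + 2"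
    using card_incident_nsets[OF finite_U u] \<open>card U \<ge> 1\<close> by simp
  also have "\<dots> = (\<Sum>f \<in> {f \<in> [U]\<^bsup>2\<^esup>. u \<in> f}. card {e \<in> path_edges (P f). \<phi> u \<in> e}) + 2"
    using card_path_end u by simp
  also have "\<dots> = (\<Sum>f \<in> insert g {f \<in> [U]\<^bsup>2\<^esup>. u \<in> f}. card {e \<in> path_edges (P f). \<phi> u \<in> e})"
    using two g by (subst sum.insert) auto
  also have "\<dots> \<le> (\<Sum>f \<in> [U]\<^bsup>2\<^esup>. card {e \<in> path_edges (P f). \<phi> u \<in> e})"
    using g by (intro sum_mono2) auto
  also have "\<dots> = card {e \<in> used. \<phi> u \<in> e}"
    by (simp add: card_used_Collect)
  also have "\<dots> \<le> degree G (\<phi> u)"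
    unfolding degree_def using fin used_subset by (intro card_mono) auto
  finally show ?thesis .
qed

text \<open>With both ends in \<open>S\<close>, each path crosses an even number of times; the sum
  over all paths stays even.\<close>

lemma even_used_crossing:
  assumes "\<phi> ` U \<subseteq> S"
  shows "even (card (used \<inter> crossing S))"
proof -
  have "even (card {e \<in> path_edges (P f). e \<in> crossing S})" if f: "f \<in> [U]\<^bsup>2\<^esup>" for f
  proof -
    have "\<phi> ` f \<subseteq> S"
      using f assms by (auto simp: nsets_def)
    then have "{hd (P f), last (P f)} \<subseteq> S"
      using ends[OF f] by simp
    then show ?thesis
      using even_card_path_crossing[of "P f" S] path[OF f] by (auto simp: is_path_def Int_def)
  qed
  then show ?thesis
    using card_used_Collect[of "\<lambda>e. e \<in> crossing S"] by (simp add: Int_def dvd_sum)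
qed

end

section \<open>The pendant graphs\<close>

lemma is_path_length_3:
  assumes "is_path (complete_graph V) p" "length p = 3"
  obtains x m y where "p = [x, m, y]" "x \<noteq> m" "m \<noteq> y" "x \<noteq> y" "{x, m, y} \<subseteq> V"
proof -
  obtain x m y where "p = [x, m, y]"
    using assms(2) by (auto simp: numeral_3_eq_3 length_Suc_conv)
  then show ?thesis
    using assms(1) that by (auto simp: is_path_def complete_graph_def)
qed

text \<open>The middle vertices of the three deleted paths lose two edges; all other vertices lose
  at most one, as path ends or because \<open>M\<close> is a matching. The two non-neighbours in the
  last claim are the ends of the deleted path with middle \<open>v\<close>.\<close>

lemma is_P_degrees:
  assumes "is_P d Q"
  shows "finite (verts Q)" "card (verts Q) = d + 1" "edges Q \<subseteq> [verts Q]\<^bsup>2\<^esup>"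
    and "\<exists>m1 m2 m3. distinct [m1, m2, m3] \<and> {v \<in> verts Q. degree Q v = d - 2} = {m1, m2, m3}"
    and "v \<in> verts Q \<Longrightarrow> degree Q v \<in> {d - 2..d}"
    and "v \<in> verts Q \<Longrightarrow> degree Q v = d - 2 \<Longrightarrow>
      \<exists>x \<in> verts Q. \<exists>y \<in> verts Q. x \<noteq> y \<and> {v, x} \<notin> edges Q \<and> {v, y} \<notin> edges Q \<and>
        degree Q x \<noteq> d - 2 \<and> degree Q y \<noteq> d - 2"
proof -
  obtain V p q r M where V: "finite V" "card V = d + 1"
    and pqr: "is_path (complete_graph V) p" "length p = 3" "is_path (complete_graph V) q" "length q = 3"
      "is_path (complete_graph V) r" "length r = 3"
      "set p \<inter> set q = {}" "set p \<inter> set r = {}" "set q \<inter> set r = {}"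
    and M: "maximum_matching (complete_graph (V - (set p \<union> set q \<union> set r))) M"
    and Q: "Q = \<lparr>verts = V,
             edges = [V]\<^bsup>2\<^esup> - (path_edges p \<union> path_edges q \<union> path_edges r) - M\<rparr>"
    using assms unfolding is_P_def by blast
  obtain x1 m1 y1 where p: "p = [x1, m1, y1]" "x1 \<noteq> m1" "m1 \<noteq> y1" "x1 \<noteq> y1" "{x1, m1, y1} \<subseteq> V"
    using is_path_length_3[OF pqr(1,2)] by metis
  obtain x2 m2 y2 where q: "q = [x2, m2, y2]" "x2 \<noteq> m2" "m2 \<noteq> y2" "x2 \<noteq> y2" "{x2, m2, y2} \<subseteq> V"
    using is_path_length_3[OF pqr(3,4)] by metis
  obtain x3 m3 y3 where r: "r = [x3, m3, y3]" "x3 \<noteq> m3" "m3 \<noteq> y3" "x3 \<noteq> y3" "{x3, m3, y3} \<subseteq> V"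
    using is_path_length_3[OF pqr(5,6)] by metis
  have dist: "distinct [x1, m1, y1, x2, m2, y2, x3, m3, y3]"
    using p q r pqr(7-9) by auto
  \<comment> \<open>Reversing the list yields each inequality in the other orientation too, so that
    \<open>neqs\<close> rewrites both \<open>x = y\<close> and \<open>y = x\<close>.\<close>
  have "distinct [y3, m3, x3, y2, m2, x2, y1, m1, x1]"
    using dist by (metis distinct_rev rev.simps append.simps)
  note neqs = dist[simplified] this[simplified]
  define W where "W = {x1, m1, y1, x2, m2, y2, x3, m3, y3}"
  have "W = set p \<union> set q \<union> set r"
    using p(1) q(1) r(1) by (simp add: W_def insert_commute)
  then have M_sub: "M \<subseteq> [V - W]\<^bsup>2\<^esup>" and M_disj: "pairwise disjnt M"
    using M by (auto simp: maximum_matching_def matching_def complete_graph_def)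
  \<comment> \<open>As a list, \<open>E\<close> can be filtered by the simplifier, which computes
    the deleted path edges at each vertex of \<open>W\<close>; \<open>R\<close> collects all deleted
    edges.\<close>
  define E where "E = [{m1, x1}, {m1, y1}, {m2, x2}, {m2, y2}, {m3, x3}, {m3, y3}]"
  define R where "R = set E \<union> M"
  have Q_eq: "verts Q = V" "edges Q = [V]\<^bsup>2\<^esup> - R"
  proof -
    have "path_edges p \<union> path_edges q \<union> path_edges r = set E"
      unfolding p(1) q(1) r(1) E_def by (simp add: insert_commute)
    then show "verts Q = V" "edges Q = [V]\<^bsup>2\<^esup> - R"
      by (simp_all add: Q R_def Diff_Un Diff_eq Int_assoc Compl_Un)
  qed
  show "finite (verts Q)" "card (verts Q) = d + 1" "edges Q \<subseteq> [verts Q]\<^bsup>2\<^esup>"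
    using V Q_eq by auto
  have nine: "card W = 9"
    using dist by (simp add: W_def)
  have "W \<subseteq> V"
    using p(5) q(5) r(5) by (simp add: W_def)
  \<comment> \<open>This gives \<open>d \<ge> 8\<close>, which keeps \<open>d - 2\<close> and
    \<open>d - 1\<close> apart under truncated subtraction.\<close>
  then have "9 \<le> d + 1"
    using card_mono[OF V(1), of W] nine V(2) by simp
  have "set E \<subseteq> [V]\<^bsup>2\<^esup>"
    using p(2-5) q(2-5) r(2-5) by (simp add: E_def)
  moreover have "M \<subseteq> [V]\<^bsup>2\<^esup>"
    using M_sub by (rule order_trans) (auto simp: nsets_def)
  ultimately have R_sub: "R \<subseteq> [V]\<^bsup>2\<^esup>"
    by (simp add: R_def)
  have deg: "degree Q v = d - card {e \<in> R. v \<in> e}" if "v \<in> V" for v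
  proof -
    have "{e \<in> edges Q. v \<in> e} = {e \<in> [V]\<^bsup>2\<^esup>. v \<in> e} - {e \<in> R. v \<in> e}"
      using Q_eq by auto
    moreover have "{e \<in> R. v \<in> e} \<subseteq> {e \<in> [V]\<^bsup>2\<^esup>. v \<in> e}"
      using R_sub by blast
    moreover have "finite ([V]\<^bsup>2\<^esup>)"
      using V by (simp add: finite_imp_finite_nsets)
    moreover have "finite {e \<in> R. v \<in> e}"
      using calculation(2,3) finite_subset[of _ "{e \<in> [V]\<^bsup>2\<^esup>. v \<in> e}"] by simp
    ultimately have "degree Q v = card {e \<in> [V]\<^bsup>2\<^esup>. v \<in> e} - card {e \<in> R. v \<in> e}"
      unfolding degree_def by (simp only: card_Diff_subset)
    then show ?thesis
      using card_incident_nsets[OF V(1) that] V(2) by simp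
  qed
  have out: "e \<inter> W = {}" if "e \<in> M" for e
    using that M_sub by (auto simp: nsets_def)
  have R_at: "{e \<in> R. v \<in> e} = set (filter (\<lambda>e. v \<in> e) E)" if "v \<in> W" for v
    unfolding R_def using out that by auto
  have mid: "degree Q m = d - 2" if "m \<in> {m1, m2, m3}" for m
  proof -
    have "m \<in> V"
      using that \<open>W \<subseteq> V\<close> by (auto simp: W_def)
    have "{e \<in> R. m1 \<in> e} = {{m1, x1}, {m1, y1}}" "{e \<in> R. m2 \<in> e} = {{m2, x2}, {m2, y2}}"
      "{e \<in> R. m3 \<in> e} = {{m3, x3}, {m3, y3}}"
      by (simp_all add: neqs R_at W_def E_def)
    moreover have "card {{m, x}, {m, y}} = 2" if "x \<noteq> y" for x m y :: 'a
      using that by (simp add: doubleton_eq_iff)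
    moreover have "m = m1 \<or> m = m2 \<or> m = m3"
      using that by simp
    ultimately have "card {e \<in> R. m \<in> e} = 2"
      by (elim disjE) (simp_all only: neqs not_False_eq_True)
    then show ?thesis
      using deg[of m] that \<open>m \<in> V\<close> by simp
  qed
  have other: "card {e \<in> R. v \<in> e} \<le> 1" if "v \<in> V" "v \<notin> {m1, m2, m3}" for v
  proof (cases "v \<in> W")
    case True
    then have "v = x1 \<or> v = y1 \<or> v = x2 \<or> v = y2 \<or> v = x3 \<or> v = y3"
      using that(2) by (simp add: W_def)
    then show ?thesis
      by (elim disjE) (simp_all add: neqs R_at W_def E_def)
  next
    case False
    then have M_at: "{e \<in> R. v \<in> e} = {e \<in> M. v \<in> e}"
      by (auto simp: R_def E_def W_def)
    show ?thesis
    proof (cases "\<exists>e \<in> M. v \<in> e")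
      case True
      then obtain e where "e \<in> M" "v \<in> e" by blast
      then have "{e \<in> M. v \<in> e} = {e}"
        using M_disj by (auto simp: pairwise_def disjnt_def)
      then show ?thesis
        by (simp add: M_at)
    next
      case False
      then have "{e \<in> M. v \<in> e} = {}" by blast
      then show ?thesis
        by (simp only: M_at card.empty)
    qed
  qed
  have other_deg: "degree Q v \<in> {d - 1..d}" if "v \<in> V" "v \<notin> {m1, m2, m3}" for v
    using deg[OF that(1)] other[OF that] by auto
  have mids: "degree Q v = d - 2 \<longleftrightarrow> v \<in> {m1, m2, m3}" if "v \<in> V" for v
    using mid[of v] other_deg[OF that] \<open>9 \<le> d + 1\<close> by (cases "v \<in> {m1, m2, m3}") auto
  show "\<exists>m1 m2 m3. distinct [m1, m2, m3] \<and> {v \<in> verts Q. degree Q v = d - 2} = {m1, m2, m3}"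
  proof (intro exI conjI)
    show "distinct [m1, m2, m3]"
      by (simp add: neqs)
    have "{m1, m2, m3} \<subseteq> V"
      using \<open>W \<subseteq> V\<close> by (simp add: W_def)
    then show "{v \<in> verts Q. degree Q v = d - 2} = {m1, m2, m3}"
      unfolding Q_eq using mids by blast
  qed
  show "degree Q v \<in> {d - 2..d}" if "v \<in> verts Q"
  proof (cases "v \<in> {m1, m2, m3}")
    case True
    then show ?thesis
      using mid[OF True] by simp
  next
    case False
    have "v \<in> V"
      using that Q_eq by simp
    then show ?thesis
      using other_deg[OF _ False] by auto
  qed
  show "\<exists>x \<in> verts Q. \<exists>y \<in> verts Q. x \<noteq> y \<and> {v, x} \<notin> edges Q \<and> {v, y} \<notin> edges Q \<and>
        degree Q x \<noteq> d - 2 \<and> degree Q y \<noteq> d - 2" if v: "v \<in> verts Q" "degree Q v = d - 2"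
  proof -
    have "v = m1 \<or> v = m2 \<or> v = m3"
      using mids[of v] v Q_eq by simp
    then have "\<exists>x y. x \<in> W \<and> y \<in> W \<and> x \<noteq> y \<and> {v, x} \<in> R \<and> {v, y} \<in> R
        \<and> x \<notin> {m1, m2, m3} \<and> y \<notin> {m1, m2, m3}"
    proof (elim disjE)
      assume "v = m1"
      then show ?thesis
        by (intro exI[of _ x1] exI[of _ y1]) (simp add: neqs R_def E_def W_def)
    next
      assume "v = m2"
      then show ?thesis
        by (intro exI[of _ x2] exI[of _ y2]) (simp add: neqs R_def E_def W_def)
    next
      assume "v = m3"
      then show ?thesis
        by (intro exI[of _ x3] exI[of _ y3]) (simp add: neqs R_def E_def W_def)
    qed
    then obtain x y where xy: "x \<in> W" "y \<in> W" "x \<noteq> y" "{v, x} \<in> R" "{v, y} \<in> R"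
      "x \<notin> {m1, m2, m3}" "y \<notin> {m1, m2, m3}"
      by blast
    then have "x \<in> V" "y \<in> V"
      using \<open>W \<subseteq> V\<close> by auto
    then show ?thesis
      using xy mids[of x] mids[of y] unfolding Q_eq
      by (intro bexI[of _ x] bexI[of _ y] conjI) simp_all
  qed
qed

section \<open>The ring of bays\<close>

text \<open>The data of \<open>is_G\<close>, with the bay to which a copy is attached turned into a
  function \<open>home\<close>.\<close>

locale bay_ring =
  fixes d n :: nat and G :: "'a graph" and a :: "nat \<Rightarrow> nat \<Rightarrow> 'a" and \<Q> :: "'a graph set"
    and t :: "'a \<Rightarrow> 'a" and home :: "'a graph \<Rightarrow> nat"
  assumes d_ge: "d \<ge> 8" and n_ge: "n \<ge> 1"
    and inj_a: "inj_on (\<lambda>(i, j). a i j) ({..<n} \<times> {1..d - 2})"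
    and finite_Q: "finite \<Q>"
    and is_P: "Q \<in> \<Q> \<Longrightarrow> is_P d Q"
    and disjoint_Q: "pairwise (\<lambda>Q R. disjnt (verts Q) (verts R)) \<Q>"
    and disjoint_bay: "Q \<in> \<Q> \<Longrightarrow> i < n \<Longrightarrow> disjnt (verts Q) (bay d a i)"
    and home: "Q \<in> \<Q> \<Longrightarrow> home Q < n"
    and attached: "Q \<in> \<Q> \<Longrightarrow> v \<in> verts Q \<Longrightarrow> degree Q v = d - 2 \<Longrightarrow> t v \<in> bay d a (home Q)"
    and verts_G: "verts G = (\<Union>i<n. bay d a i) \<union> (\<Union>Q \<in> \<Q>. verts Q)"
    and edges_G: "edges G = (\<Union>i<n. [bay d a i]\<^bsup>2\<^esup>) \<union> bay_connections d n a \<union> (\<Union>Q \<in> \<Q>. edges Q) \<union>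
          {{v, t v} | Q v. Q \<in> \<Q> \<and> v \<in> verts Q \<and> degree Q v = d - 2}"
    and bay_degree: "i < n \<Longrightarrow> v \<in> bay d a i \<Longrightarrow> degree G v \<ge> d - 1"
begin

definition width :: nat where
  "width = nat \<lceil>real (d - 2) / 2\<rceil>"

text \<open>For \<open>n = 1\<close> and odd \<open>d\<close> the middle index gives a one-element
  set, which is no edge. Links therefore only bound the connecting edges from above.\<close>

definition link :: "nat \<Rightarrow> nat \<Rightarrow> 'a set" where
  "link i j = {a i j, a ((i + n - 1) mod n) (d - 1 - j)}"

text \<open>An interval of bays has two boundaries with at most \<open>width\<close> links each, so
  this bounds its cut.\<close>

lemma width_le: "2 * width \<le> d - 1"
proof -
  let ?c = "\<lceil>real (d - 2) / 2\<rceil>"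
  have "real_of_int ?c - 1 < real (d - 2) / 2"
    using ceiling_correct[of "real (d - 2) / 2"] by linarith
  then have "2 * ?c - 2 < int (d - 2)"
    by linarith
  then show ?thesis
    unfolding width_def using d_ge by linarith
qed

lemma bay_connections_subset: "bay_connections d n a \<subseteq> (\<lambda>(i, j). link i j) ` ({..<n} \<times> {1..width})"
  by (auto simp: bay_connections_def link_def width_def)

lemma edge_cases [consumes 1, case_names bay link pendant attachment]:
  assumes "e \<in> edges G"
  obtains i where "i < n" "e \<in> [bay d a i]\<^bsup>2\<^esup>"
  | i j where "i < n" "j \<in> {1..width}" "e = link i j"
  | Q where "Q \<in> \<Q>" "e \<in> edges Q"
  | Q v where "Q \<in> \<Q>" "v \<in> verts Q" "degree Q v = d - 2" "e = {v, t v}"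
  using assms bay_connections_subset unfolding edges_G by blast

lemma finite_bay: "finite (bay d a i)"
  by (simp add: bay_def)

lemma card_bay_le: "card (bay d a i) \<le> d - 2"
  unfolding bay_def using card_image_le[of "{1..d - 2}" "a i"] by simp

lemma a_in_bay: "j \<in> {1..d - 2} \<Longrightarrow> a i j \<in> bay d a i"
  by (simp add: bay_def)

lemma a_eq_iff:
  assumes "i < n" "i' < n" "j \<in> {1..d - 2}" "j' \<in> {1..d - 2}"
  shows "a i j = a i' j' \<longleftrightarrow> i = i' \<and> j = j'"
  using inj_onD[OF inj_a, of "(i, j)" "(i', j')"] assms by auto

lemma bay_index_unique:
  assumes "x \<in> bay d a i" "x \<in> bay d a i'" "i < n" "i' < n"
  shows "i = i'"
  using assms a_eq_iff by (auto simp: bay_def)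

lemma link_ends:
  assumes "i < n" "j \<in> {1..width}"
  shows "a i j \<in> bay d a i" "a ((i + n - 1) mod n) (d - 1 - j) \<in> bay d a ((i + n - 1) mod n)"
  using assms width_le d_ge by (auto intro!: a_in_bay)

section \<open>Degrees at the copies of \<open>P\<^sub>d\<close> and the minimum degree\<close>

lemma pendant_unique:
  assumes "Q \<in> \<Q>" "R \<in> \<Q>" "v \<in> verts Q" "v \<in> verts R"
  shows "Q = R"
  using disjoint_Q assms by (auto simp: pairwise_def disjnt_def)

lemma pendant_not_bay:
  assumes "Q \<in> \<Q>" "v \<in> verts Q" "i < n"
  shows "v \<notin> bay d a i"
  using disjoint_bay assms by (auto simp: disjnt_def)

lemma edges_pendant_subset: "Q \<in> \<Q> \<Longrightarrow> e \<in> edges Q \<Longrightarrow> e \<subseteq> verts Q"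
  using is_P_degrees(3)[OF is_P] by (auto simp: nsets_def)

lemma finite_edges_pendant: "Q \<in> \<Q> \<Longrightarrow> finite (edges Q)"
  using is_P_degrees(1,3)[OF is_P] finite_subset finite_imp_finite_nsets by metis

lemma finite_verts: "finite (verts G)"
  unfolding verts_G using finite_Q is_P_degrees(1)[OF is_P] by (auto simp: finite_bay)

lemma finite_edges: "finite (edges G)"
proof -
  have "{{v, t v} | Q v. Q \<in> \<Q> \<and> v \<in> verts Q \<and> degree Q v = d - 2}
      \<subseteq> (\<Union>Q \<in> \<Q>. (\<lambda>v. {v, t v}) ` verts Q)"
    by auto
  moreover have "finite (\<Union>Q \<in> \<Q>. (\<lambda>v. {v, t v}) ` verts Q)"
    using finite_Q is_P_degrees(1)[OF is_P] by auto
  ultimately have "finite {{v, t v} | Q v. Q \<in> \<Q> \<and> v \<in> verts Q \<and> degree Q v = d - 2}"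
    by (rule finite_subset)
  moreover have "finite (bay_connections d n a)"
    using bay_connections_subset by (rule finite_subset) simp
  ultimately show ?thesis
    unfolding edges_G using finite_Q finite_edges_pendant
    by (auto simp: finite_bay finite_imp_finite_nsets)
qed

text \<open>Bay edges, links and the edges belonging to other copies avoid the vertices of
  \<open>Q\<close> by disjointness, and an attachment edge has only one end outside the
  bays.\<close>

lemma edge_at_pendant:
  assumes "Q \<in> \<Q>" "v \<in> verts Q"
  shows "{e \<in> edges G. v \<in> e}
    = {e \<in> edges Q. v \<in> e} \<union> (if degree Q v = d - 2 then {{v, t v}} else {})" (is "?L = ?R")
proof
  show "?L \<subseteq> ?R"
  proof
    fix e
    assume "e \<in> ?L"
    then have "e \<in> edges G" "v \<in> e" by auto
    then show "e \<in> ?R"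
    proof (cases rule: edge_cases)
      case (bay i)
      then show ?thesis
        using \<open>v \<in> e\<close> pendant_not_bay[OF assms] by (auto simp: nsets_def)
    next
      case (link i j)
      moreover have "(i + n - 1) mod n < n"
        using n_ge by simp
      ultimately show ?thesis
        using \<open>v \<in> e\<close> link_ends[of i j] pendant_not_bay[OF assms] by (auto simp: link_def)
    next
      case (pendant R)
      then show ?thesis
        using \<open>v \<in> e\<close> edges_pendant_subset[of R e] pendant_unique[of Q R v] assms by auto
    next
      case (attachment R w)
      then have "v \<noteq> t w"
        using attached[of R w] pendant_not_bay[OF assms, of "home R"] home[of R] by auto
      then have "v = w"
        using attachment \<open>v \<in> e\<close> by simp
      then show ?thesis
        using attachment pendant_unique[of Q R v] assms by auto
    qed
  qed
  show "?R \<subseteq> ?L"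
    using assms unfolding edges_G by auto
qed

lemma attachment_notin_pendant:
  assumes "Q \<in> \<Q>" "v \<in> verts Q" "degree Q v = d - 2"
  shows "t v \<notin> verts Q"
  using attached[OF assms] home[OF assms(1)] pendant_not_bay[OF assms(1)] by blast

lemma degree_pendant:
  assumes "Q \<in> \<Q>" "v \<in> verts Q"
  shows "degree G v = (if degree Q v = d - 2 then d - 1 else degree Q v)"
proof (cases "degree Q v = d - 2")
  case True
  have "{v, t v} \<notin> edges Q"
    using attachment_notin_pendant[OF assms True] edges_pendant_subset[OF assms(1)] by auto
  then have "degree G v = Suc (degree Q v)"
    using True finite_edges_pendant[OF assms(1)]
    by (simp add: degree_def[of G] edge_at_pendant[OF assms]) (simp add: degree_def)
  then show ?thesis
    using True d_ge by simp
next
  case False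
  then show ?thesis
    by (simp add: degree_def[of G] edge_at_pendant[OF assms]) (simp add: degree_def)
qed

text \<open>The lower bound serves the minimum degree; the upper bound forbids a path to run through
  a branch vertex in a copy, by \<open>degree_ge_of_passing\<close>.\<close>

lemma degree_pendant_bounds:
  assumes "Q \<in> \<Q>" "v \<in> verts Q"
  shows "degree G v \<in> {d - 1..d}"
  using degree_pendant[OF assms] is_P_degrees(5)[OF is_P[OF assms(1)] assms(2)] by auto

text \<open>Without copies, \<open>a 0 1\<close> would have at most \<open>d - 3\<close> neighbours
  in its bay and one link, too few for degree \<open>d - 1\<close>. A copy is needed because its
  vertices of degree \<open>d - 2\<close> attain the minimum degree of \<open>G\<close>.\<close>

lemma exists_pendant: "\<Q> \<noteq> {}"
proof
  assume "\<Q> = {}"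
  let ?v = "a 0 1" and ?f = "link 0 1"
  have v: "?v \<in> bay d a 0"
    using d_ge by (intro a_in_bay) simp
  have "{e \<in> edges G. ?v \<in> e} \<subseteq> insert ?f {e \<in> [bay d a 0]\<^bsup>2\<^esup>. ?v \<in> e}"
  proof
    fix e
    assume "e \<in> {e \<in> edges G. ?v \<in> e}"
    then have "e \<in> edges G" "?v \<in> e" by auto
    then show "e \<in> insert ?f {e \<in> [bay d a 0]\<^bsup>2\<^esup>. ?v \<in> e}"
    proof (cases rule: edge_cases)
      case (bay i)
      then have "i = 0"
        using v \<open>?v \<in> e\<close> bay_index_unique[of ?v i 0] n_ge by (auto simp: nsets_def)
      then show ?thesis
        using bay \<open>?v \<in> e\<close> by simp
    next
      case (link i j)
      \<comment> \<open>The second index of a link is at least \<open>(d - 1) / 2 > 1\<close>, so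
        \<open>a 0 1\<close> occurs only as the first end, in \<open>link 0 1\<close>.\<close>
      have "2 * j \<le> d - 1"
        using link width_le by simp
      then have "d - 1 - j \<noteq> 1" "d - 1 - j \<in> {1..d - 2}" "1 \<in> {1..d - 2}"
        using d_ge link(2) by auto
      moreover have "(i + n - 1) mod n < n" "0 < n"
        using n_ge by simp_all
      ultimately have "?v \<noteq> a ((i + n - 1) mod n) (d - 1 - j)"
        using a_eq_iff[of 0 "(i + n - 1) mod n" 1 "d - 1 - j"] by simp
      then have "a i j = a 0 1"
        using link \<open>?v \<in> e\<close> by (auto simp: link_def)
      then have "i = 0 \<and> j = 1"
        using link width_le d_ge n_ge a_eq_iff[of i 0 j 1] by auto
      then show ?thesis
        using link by simp
    qed (use \<open>\<Q> = {}\<close> in auto)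
  qed
  then have "degree G ?v \<le> card (insert ?f {e \<in> [bay d a 0]\<^bsup>2\<^esup>. ?v \<in> e})"
    unfolding degree_def by (intro card_mono) (simp_all add: finite_bay finite_imp_finite_nsets)
  also have "\<dots> \<le> Suc (card {e \<in> [bay d a 0]\<^bsup>2\<^esup>. ?v \<in> e})"
    by (rule card_insert_le_m1) simp_all
  also have "\<dots> \<le> d - 2"
    using card_incident_nsets[OF finite_bay v] card_bay_le[of 0] d_ge by simp
  finally show False
    using bay_degree[of 0 ?v] v n_ge d_ge by simp
qed

lemma min_degree_eq: "min_degree G = d - 1"
proof -
  obtain Q where Q: "Q \<in> \<Q>"
    using exists_pendant by blast
  then obtain m where m: "m \<in> verts Q" "degree Q m = d - 2"
    using is_P_degrees(4)[OF is_P] by blast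
  have "degree G m = d - 1" "m \<in> verts G"
    using degree_pendant[OF Q m(1)] m Q by (auto simp: verts_G)
  moreover have "d - 1 \<le> degree G v" if "v \<in> verts G" for v
    using that bay_degree degree_pendant_bounds by (auto simp: verts_G)
  ultimately show ?thesis
    unfolding min_degree_def using finite_verts by (intro Min_eqI) force+
qed

section \<open>Small edge cuts\<close>

text \<open>The copies of \<open>P\<^sub>d\<close> go with the bay they are attached to, so that only links are cut.\<close>

definition segment :: "nat set \<Rightarrow> 'a set" where
  "segment I = (\<Union>i \<in> I. bay d a i) \<union> (\<Union>Q \<in> {Q \<in> \<Q>. home Q \<in> I}. verts Q)"

lemma bay_in_segment_iff:
  assumes "x \<in> bay d a i" "i < n" "I \<subseteq> {..<n}"
  shows "x \<in> segment I \<longleftrightarrow> i \<in> I"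
proof -
  have "x \<notin> verts Q" if "Q \<in> \<Q>" for Q
    using pendant_not_bay[OF that] assms by blast
  moreover have "i = i'" if "i' \<in> I" "x \<in> bay d a i'" for i'
    using bay_index_unique[of x i i'] that assms by auto
  ultimately show ?thesis
    using assms(1) unfolding segment_def by blast
qed

lemma pendant_in_segment_iff:
  assumes "v \<in> verts Q" "Q \<in> \<Q>" "I \<subseteq> {..<n}"
  shows "v \<in> segment I \<longleftrightarrow> home Q \<in> I"
proof -
  have "v \<notin> bay d a i" if "i \<in> I" for i
    using pendant_not_bay[of Q v i] that assms by auto
  moreover have "R = Q" if "R \<in> \<Q>" "v \<in> verts R" for R
    using pendant_unique assms that by blast
  ultimately show ?thesis
    using assms unfolding segment_def by blast
qed

text \<open>Bay edges, copies and attachment edges stay on one side. Links between bay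
  \<open>i\<close> and its predecessor have index \<open>i\<close>, so the cut links have index
  \<open>l\<close> or \<open>u\<close>; for \<open>u = n\<close> the latter wraps around to
  \<open>0\<close>.\<close>

lemma segment_cut:
  assumes "l \<le> u" "u \<le> n"
  shows "edges G \<inter> crossing (segment {l..<u}) \<subseteq> (\<lambda>(i, j). link i j) ` ({l, u mod n} \<times> {1..width})"
proof
  fix e
  let ?I = "{l..<u}"
  have I: "?I \<subseteq> {..<n}"
    using assms by auto
  assume "e \<in> edges G \<inter> crossing (segment ?I)"
  then have e: "e \<in> edges G" "e \<in> crossing (segment ?I)" by auto
  then obtain x y where xy: "x \<in> e" "y \<in> e" "x \<in> segment ?I" "y \<notin> segment ?I"
    by (auto simp: crossing_def)
  from e(1) show "e \<in> (\<lambda>(i, j). link i j) ` ({l, u mod n} \<times> {1..width})"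
  proof (cases rule: edge_cases)
    case (bay i)
    then have "x \<in> bay d a i" "y \<in> bay d a i"
      using xy by (auto simp: nsets_def)
    then show ?thesis
      using bay_in_segment_iff[OF _ _ I] xy bay by blast
  next
    case (link i j)
    let ?i = "(i + n - 1) mod n"
    have "?i < n"
      using n_ge by simp
    then have iff: "a i j \<in> segment ?I \<longleftrightarrow> i \<in> ?I" "a ?i (d - 1 - j) \<in> segment ?I \<longleftrightarrow> ?i \<in> ?I"
      using bay_in_segment_iff[OF link_ends(1)[OF link(1,2)] _ I]
        bay_in_segment_iff[OF link_ends(2)[OF link(1,2)] _ I] link(1) by auto
    have neq: "i \<in> ?I \<longleftrightarrow> ?i \<notin> ?I"
      using xy link(3) iff unfolding link_def by blast
    \<comment> \<open>Exactly one of bay \<open>i\<close> and its predecessor is inside. If it is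
      \<open>i\<close>, the interval starts at \<open>i = l\<close>; otherwise it ends just before
      \<open>i\<close>, which for \<open>i = 0\<close> means \<open>u = n\<close>.\<close>
    have "i = l \<or> i = u mod n"
    proof (cases "i = 0")
      case True
      then have "?i = n - 1"
        using n_ge by simp
      then show ?thesis
        using neq True assms n_ge by (cases "u = n") auto
    next
      case False
      then have "i + n - 1 = (i - 1) + n" by simp
      then have "?i = (i - 1 + n) mod n"
        by (simp only:)
      also have "\<dots> = i - 1"
        using link(1) by simp
      finally have "?i = i - 1" .
      then show ?thesis
        using neq False assms link(1) by (cases "u = n") auto
    qed
    then show ?thesis
      using link by auto
  next
    case (pendant Q)
    then have "x \<in> verts Q" "y \<in> verts Q"
      using xy edges_pendant_subset[OF pendant] by auto
    then show ?thesis
      using pendant_in_segment_iff[OF _ pendant(1) I] xy by auto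
  next
    case (attachment Q v)
    have "v \<in> segment ?I \<longleftrightarrow> home Q \<in> ?I" "t v \<in> segment ?I \<longleftrightarrow> home Q \<in> ?I"
      using pendant_in_segment_iff[OF attachment(2,1) I]
        bay_in_segment_iff[OF attached[OF attachment(1-3)] home[OF attachment(1)] I] by simp_all
    then show ?thesis
      using xy attachment(4) by auto
  qed
qed

lemma card_segment_cut: "card ((\<lambda>(i, j). link i j) ` ({l, u} \<times> {1..width})) \<le> d - 1"
proof -
  have "card ((\<lambda>(i, j). link i j) ` ({l, u} \<times> {1..width})) \<le> card ({l, u} \<times> {1..width})"
    by (rule card_image_le) simp
  also have "\<dots> \<le> 2 * width"
    by (simp add: card_cartesian_product card_insert_if)
  finally show ?thesis
    using width_le by linarith
qed

text \<open>With \<open>card_mids\<close>, at most three edges leave a copy.\<close>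

lemma pendant_cut:
  assumes "Q \<in> \<Q>"
  shows "edges G \<inter> crossing (verts Q) \<subseteq> (\<lambda>v. {v, t v}) ` {v \<in> verts Q. degree Q v = d - 2}"
proof
  fix e
  assume "e \<in> edges G \<inter> crossing (verts Q)"
  then obtain v where v: "e \<in> edges G" "v \<in> e" "v \<in> verts Q" "\<not> e \<subseteq> verts Q"
    by (auto simp: crossing_def)
  have "e \<notin> edges Q"
    using v(4) edges_pendant_subset[OF assms] by blast
  moreover have "e \<in> {e \<in> edges Q. v \<in> e} \<union> (if degree Q v = d - 2 then {{v, t v}} else {})"
    unfolding edge_at_pendant[OF assms v(3), symmetric] using v by simp
  ultimately have "degree Q v = d - 2" "e = {v, t v}"
    by (simp_all split: if_splits)
  then show "e \<in> (\<lambda>v. {v, t v}) ` {v \<in> verts Q. degree Q v = d - 2}"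
    using v(3) by simp
qed

lemma card_mids:
  assumes "Q \<in> \<Q>"
  shows "card {v \<in> verts Q. degree Q v = d - 2} = 3"
proof -
  obtain m1 m2 m3 where "distinct [m1, m2, m3]" "{v \<in> verts Q. degree Q v = d - 2} = {m1, m2, m3}"
    using is_P_degrees(4)[OF is_P[OF assms]] by blast
  then show ?thesis by simp
qed

section \<open>Excluding immersed cliques\<close>

lemma no_clique_in_pendant:
  assumes "clique_immersion G U \<phi> P" "card U = d" "Q \<in> \<Q>"
  shows "\<not> \<phi> ` U \<subseteq> verts Q"
proof
  assume image: "\<phi> ` U \<subseteq> verts Q"
  interpret clique_immersion G U \<phi> P by fact
  let ?S = "verts Q" and ?M = "{v \<in> verts Q. degree Q v = d - 2}"
  let ?C = "(\<lambda>v. {v, t v}) ` ?M"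
  have fin_Q: "finite (verts Q)" and card_Q: "card (verts Q) = d + 1"
    using is_P_degrees(1,2)[OF is_P[OF assms(3)]] by auto
  have "inj_on (\<lambda>v. {v, t v}) ?M"
    using attachment_notin_pendant[OF assms(3)] by (auto simp: inj_on_def doubleton_eq_iff)
  then have "card ?C = 3"
    by (simp only: card_image card_mids[OF assms(3)])
  have crossing_used: "used \<inter> crossing ?S \<subseteq> ?C"
    using used_subset pendant_cut[OF assms(3)] by blast
  \<comment> \<open>An even number of crossing edges is used, whereas \<open>?C\<close> has
    three.\<close>
  have "used \<inter> crossing ?S \<noteq> ?C"
    using even_used_crossing[OF image] \<open>card ?C = 3\<close> by auto
  then obtain e where "e \<in> ?C" "e \<notin> used \<inter> crossing ?S"
    using crossing_used by blast
  then obtain m where m: "m \<in> verts Q" "degree Q m = d - 2" "{m, t m} \<notin> used \<inter> crossing ?S"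
    by auto
  then have unused: "{m, t m} \<notin> used"
    using attachment_notin_pendant[OF assms(3) m(1,2)] by (auto simp: crossing_def)

  \<comment> \<open>A branch vertex needs \<open>d - 1\<close> used edges, but without
    \<open>{m, t m}\<close> only the \<open>d - 2\<close> edges of \<open>Q\<close> remain at
    \<open>m\<close>.\<close>
  have "m \<notin> \<phi> ` U"
  proof
    assume "m \<in> \<phi> ` U"
    then obtain u where u: "u \<in> U" "m = \<phi> u" by blast
    have "{e \<in> used. m \<in> e} \<subseteq> {e \<in> edges G. m \<in> e}"
      using used_subset by blast
    then have "{e \<in> used. m \<in> e} \<subseteq> {e \<in> edges Q. m \<in> e}"
      unfolding edge_at_pendant[OF assms(3) m(1)] using unused m(2) by auto
    then have "card {e \<in> used. m \<in> e} \<le> degree Q m"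
      unfolding degree_def using finite_edges_pendant[OF assms(3)] by (intro card_mono) auto
    then show False
      using used_degree[OF u(1)] u(2) m(2) assms(2) d_ge by simp
  qed
  then have "\<phi> ` U \<subseteq> verts Q - {m}"
    using image by blast
  moreover have "card (\<phi> ` U) = card (verts Q - {m})"
    using m(1) card_Q fin_Q by (simp add: card_image[OF inj] assms(2))
  ultimately have image_eq: "\<phi> ` U = verts Q - {m}"
    using fin_Q by (intro card_subset_eq) auto

  \<comment> \<open>Any vertex of \<open>Q\<close> other than \<open>m\<close> is a branch vertex,
    and running through it would require degree \<open>d + 1\<close>. Inside \<open>Q\<close>, a
    path can thus have only \<open>m\<close> as an inner vertex.\<close>
  have only_m: "z = m \<or> z \<in> \<phi> ` f" if z: "f \<in> [U]\<^bsup>2\<^esup>" "z \<in> set (P f)" "z \<in> verts Q" for f z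
  proof (rule ccontr)
    assume "\<not> (z = m \<or> z \<in> \<phi> ` f)"
    then obtain u where u: "u \<in> U" "z = \<phi> u" "u \<notin> f"
      using image_eq z(3) by blast
    then show False
      using degree_ge_of_passing[OF u(1) z(1) u(3)] degree_pendant_bounds[OF assms(3) z(3)]
        z(2) finite_edges assms(2) by auto
  qed

  have "?M \<noteq> {m}"
    using card_mids[OF assms(3)] by auto
  then obtain m' where m': "m' \<in> verts Q" "degree Q m' = d - 2" "m' \<noteq> m"
    using m by blast
  \<comment> \<open>Since \<open>m\<close> has degree \<open>d - 2\<close> in \<open>Q\<close> while
    \<open>x\<close> and \<open>y\<close> do not, both differ from \<open>m\<close> and are branch
    vertices.\<close>
  then obtain x y where xy: "x \<in> verts Q" "y \<in> verts Q" "x \<noteq> y" "{m', x} \<notin> edges Q" "{m', y} \<notin> edges Q"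
    "degree Q x \<noteq> d - 2" "degree Q y \<noteq> d - 2"
    using is_P_degrees(6)[OF is_P[OF assms(3)] m'(1,2)] by blast
  obtain w where w: "w \<in> U" "m' = \<phi> w"
    using image_eq m' by blast

  have through_m: "{m', m} \<in> path_edges (P {w, v})"
    if v: "v \<in> U" "degree Q (\<phi> v) \<noteq> d - 2" "{m', \<phi> v} \<notin> edges Q" for v
  proof -
    let ?f = "{w, v}"
    have "w \<noteq> v"
      using v(2) m'(2) w(2) by auto
    then have f: "?f \<in> [U]\<^bsup>2\<^esup>"
      using pairI w(1) v(1) by blast
    have path_f: "path_edges (P ?f) \<subseteq> edges G" "P ?f \<noteq> []" "distinct (P ?f)"
      using path[OF f] by (auto simp: is_path_def)
    have path_used: "path_edges (P ?f) \<subseteq> used"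
      unfolding used_def by (rule UN_upper[OF f])
    have "card {e \<in> path_edges (P ?f). m' \<in> e} = 1"
      using card_path_end[OF w(1) f] w(2) by simp
    then obtain e where e: "e \<in> path_edges (P ?f)" "m' \<in> e"
      by (metis (no_types, lifting) card_1_singletonE insertI1 mem_Collect_eq)
    have in_path: "e' \<subseteq> set (P ?f)" if "e' \<in> path_edges (P ?f)" for e'
      using Union_path_edges_subset[of "P ?f"] that by blast
    have "e \<notin> crossing ?S"
    proof
      assume "e \<in> crossing ?S"
      have "{hd (P ?f), last (P ?f)} \<subseteq> ?S"
        using ends[OF f] image w(1) v(1) by auto
      then have even: "even (card (path_edges (P ?f) \<inter> crossing ?S))"
        using even_card_path_crossing[OF path_f(2,3)] by simp
      have "path_edges (P ?f) \<inter> crossing ?S \<noteq> {e}"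
        using even by auto
      then obtain e' where e': "e' \<in> path_edges (P ?f)" "e' \<in> crossing ?S" "e' \<noteq> e"
        using e \<open>e \<in> crossing ?S\<close> by blast
      have "e \<in> ?C" "e' \<in> ?C"
        using e e' \<open>e \<in> crossing ?S\<close> crossing_used path_used by blast+
      then obtain z z' where z: "z \<in> ?M" "e = {z, t z}" and z': "z' \<in> ?M" "e' = {z', t z'}"
        by blast
      have "z = m'"
        using z e(2) m'(1) attachment_notin_pendant[OF assms(3), of z] by auto
      then have "z' \<noteq> m'"
        using z(2) z'(2) e'(3) by blast
      moreover have "z' \<noteq> m"
        using unused e'(1) z'(2) path_used by blast
      moreover have "z' \<noteq> \<phi> v"
        using z'(1) v(2) by blast
      moreover have "z' \<in> set (P ?f)"
        using in_path[OF e'(1)] z'(2) by simp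
      ultimately show False
        using only_m[OF f, of z'] z'(1) w(2) by auto
    qed
    then have "e \<subseteq> ?S"
      using e(2) m'(1) by (auto simp: crossing_def)
    have "e \<in> {e \<in> edges G. m' \<in> e}"
      using e path_f by blast
    moreover have "e \<noteq> {m', t m'}"
      using \<open>e \<subseteq> ?S\<close> attachment_notin_pendant[OF assms(3) m'(1,2)] by blast
    ultimately have "e \<in> edges Q"
      unfolding edge_at_pendant[OF assms(3) m'(1)] by (auto split: if_splits)
    then have "e \<in> [verts Q]\<^bsup>2\<^esup>"
      using is_P_degrees(3)[OF is_P[OF assms(3)]] by blast
    \<comment> \<open>The edge at \<open>m'\<close> stays in \<open>Q\<close> and cannot lead to the
      non-neighbour \<open>\<phi> v\<close>, so it leads to \<open>m\<close>.\<close>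
    then obtain z where z: "e = {m', z}" "z \<noteq> m'" "z \<in> verts Q"
      using e(2) by (auto simp: nsets_def card_2_iff doubleton_eq_iff)
    moreover have "z \<noteq> \<phi> v"
      using \<open>e \<in> edges Q\<close> z(1) v(3) by blast
    moreover have "z \<in> set (P ?f)"
      using in_path[OF e(1)] z(1) by simp
    ultimately have "z = m"
      using only_m[OF f, of z] w(2) by auto
    then show ?thesis
      using z(1) e(1) by simp
  qed

  obtain u v where uv: "u \<in> U" "v \<in> U" "x = \<phi> u" "y = \<phi> v"
    using image_eq xy m(2) by (metis (no_types, lifting) Diff_iff imageE singletonD)
  then have "{m', m} \<in> path_edges (P {w, u})" "{m', m} \<in> path_edges (P {w, v})"
    using through_m xy by auto
  moreover have "w \<noteq> u" "w \<noteq> v" "u \<noteq> v"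
    using uv w xy m'(2) by auto
  then have "{w, u} \<noteq> {w, v}" "{w, u} \<in> [U]\<^bsup>2\<^esup>" "{w, v} \<in> [U]\<^bsup>2\<^esup>"
    using uv w pairI by (auto simp: doubleton_eq_iff)
  ultimately show False
    using disj[of "{w, u}" "{w, v}"] by blast
qed

lemma no_clique:
  assumes card_U: "card U = d"
  shows "\<not> clique_immersion G U \<phi> P"
proof
  assume imm: "clique_immersion G U \<phi> P"
  interpret clique_immersion G U \<phi> P by fact
  have split: "card {u \<in> U. \<phi> u \<in> S} + card {u \<in> U. \<phi> u \<notin> S} = d" for S
  proof -
    have "{u \<in> U. \<phi> u \<notin> S} = U - {u \<in> U. \<phi> u \<in> S}" by blast
    then show ?thesis
      using finite_U card_U card_mono[of U "{u \<in> U. \<phi> u \<in> S}"] by (simp add: card_Diff_subset)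
  qed

  have not_in_pendant: "\<phi> u \<notin> verts Q" if "Q \<in> \<Q>" "u \<in> U" for u Q
  proof
    assume "\<phi> u \<in> verts Q"
    let ?A = "{u \<in> U. \<phi> u \<in> verts Q}" and ?B = "{u \<in> U. \<phi> u \<notin> verts Q}"
    have "?A \<noteq> {}"
      using that \<open>\<phi> u \<in> verts Q\<close> by blast
    then have "card ?A \<ge> 1"
      using finite_U by (simp add: Suc_le_eq card_gt_0_iff)
    have "?B \<noteq> {}"
      using no_clique_in_pendant[OF imm card_U that(1)] by blast
    then have "card ?B \<ge> 1"
      using finite_U by (simp add: Suc_le_eq card_gt_0_iff)
    have fin: "finite {v \<in> verts Q. degree Q v = d - 2}"
      using is_P_degrees(1)[OF is_P[OF that(1)]] by simp
    have "card ?A * card ?B \<le> card ((\<lambda>v. {v, t v}) ` {v \<in> verts Q. degree Q v = d - 2})"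
      using pendant_cut[OF that(1)] fin by (intro cut_bound) auto
    also have "\<dots> \<le> 3"
      using card_image_le[OF fin] card_mids[OF that(1)] by metis
    finally have "card ?A * card ?B \<le> 3" .
    \<comment> \<open>Here \<open>2 + i + j = d\<close>, so the product
      \<open>1 + i + j + i * j\<close> is at least \<open>d - 1 \<ge> 7\<close>.\<close>
    moreover obtain i j where "card ?A = 1 + i" "card ?B = 1 + j"
      using \<open>card ?A \<ge> 1\<close> \<open>card ?B \<ge> 1\<close> le_Suc_ex by blast
    ultimately show False
      using split[of "verts Q"] d_ge by simp
  qed

  have segment_count: "card {u \<in> U. \<phi> u \<in> segment {l..<k}} \<notin> {2..d - 2}" if "l \<le> k" "k \<le> n" for l k
  proof
    let ?A = "{u \<in> U. \<phi> u \<in> segment {l..<k}}" and ?B = "{u \<in> U. \<phi> u \<notin> segment {l..<k}}"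
    assume A: "card ?A \<in> {2..d - 2}"
    have "card ?A * card ?B \<le> d - 1"
      using cut_bound[OF _ segment_cut[OF that]] card_segment_cut[of l "k mod n"] by fastforce
    moreover have "card ?A \<ge> 2" "card ?B \<ge> 2"
      using A split[of "segment {l..<k}"] d_ge by auto
    \<comment> \<open>Now \<open>4 + i + j = d\<close>, so the product is at least
      \<open>4 + 2 * i + 2 * j = 2 * d - 4\<close>, which exceeds \<open>d - 1\<close>.\<close>
    then obtain i j where ij: "card ?A = 2 + i" "card ?B = 2 + j"
      using le_Suc_ex by blast
    moreover have "(2 + i) * (2 + j) = 4 + 2 * i + 2 * j + i * j"
      by (simp add: algebra_simps)
    ultimately have "4 + 2 * i + 2 * j \<le> d - 1"
      by simp
    then show False
      using split[of "segment {l..<k}"] ij by simp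
  qed

  define c where "c k = card {u \<in> U. \<phi> u \<in> segment {0..<k}}" for k
  have "{u \<in> U. \<phi> u \<in> segment {0..<n}} = U"
    using in_verts not_in_pendant by (fastforce simp: verts_G segment_def)
  then have "c n = d"
    using card_U by (simp add: c_def)
  have "c 0 = 0"
    by (simp add: c_def segment_def)
  \<comment> \<open>The counts run from \<open>c 0 = 0\<close> to \<open>c n = d\<close>, so there
    is a first \<open>k\<close> with at least two branch vertices, and
    \<open>c (k - 1) \<le> 1\<close>.\<close>
  define k where "k = (LEAST k. 2 \<le> c k)"
  have "2 \<le> c n"
    using \<open>c n = d\<close> d_ge by simp
  then have k: "2 \<le> c k" "k \<le> n"
    unfolding k_def by (auto intro: LeastI Least_le)
  with \<open>c 0 = 0\<close> obtain i where i: "k = Suc i"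
    by (cases k) auto
  have "\<not> 2 \<le> c i"
    using not_less_Least[of i "\<lambda>k. 2 \<le> c k"] i by (simp add: k_def)
  let ?B = "{u \<in> U. \<phi> u \<in> segment {i..<k}}"
  have "segment {0..<k} = segment {0..<i} \<union> segment {i..<k}"
    unfolding i segment_def by (auto simp: less_Suc_eq)
  then have "{u \<in> U. \<phi> u \<in> segment {0..<k}} = {u \<in> U. \<phi> u \<in> segment {0..<i}} \<union> ?B"
    by blast
  then have "c k \<le> c i + card ?B"
    by (simp only: c_def card_Un_le)
  \<comment> \<open>Copies contain no branch vertices, so the segment of the single bay
    \<open>i\<close> has at most as many as the bay has vertices. With the range excluded by
    \<open>segment_count\<close>, at most one is left.\<close>
  have "\<phi> ` ?B \<subseteq> bay d a i"
    using not_in_pendant by (auto simp: segment_def i)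
  then have "card (\<phi> ` ?B) \<le> d - 2"
    using card_mono[OF finite_bay] card_bay_le[of i] le_trans by blast
  moreover have "inj_on \<phi> ?B"
    using inj by (rule inj_on_subset) blast
  ultimately have "card ?B \<le> d - 2"
    by (simp add: card_image)
  then have "card ?B \<le> 1"
    using segment_count[of i k] i k by auto
  then have "c k = 2"
    using \<open>c k \<le> c i + card ?B\<close> \<open>\<not> 2 \<le> c i\<close> k by simp
  then show False
    using segment_count[of 0 k] k d_ge by (simp add: c_def)
qed

end

lemma is_G_imp_bay_ring:
  assumes "d \<ge> 8" "n \<ge> 1" "is_G d n G"
  obtains a \<Q> t home where "bay_ring d n G a \<Q> t home"
proof -
  obtain a \<Q> t where G: "inj_on (\<lambda>(i, j). a i j) ({..<n} \<times> {1..d - 2})"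
    "finite \<Q>" "\<forall>Q \<in> \<Q>. is_P d Q"
    "pairwise (\<lambda>Q R. disjnt (verts Q) (verts R)) \<Q>"
    "\<forall>Q \<in> \<Q>. \<forall>i < n. disjnt (verts Q) (bay d a i)"
    "\<forall>Q \<in> \<Q>. \<exists>i < n. \<forall>v \<in> verts Q. degree Q v = d - 2 \<longrightarrow> t v \<in> bay d a i"
    "verts G = (\<Union>i<n. bay d a i) \<union> (\<Union>Q \<in> \<Q>. verts Q)"
    "edges G = (\<Union>i<n. [bay d a i]\<^bsup>2\<^esup>) \<union> bay_connections d n a \<union> (\<Union>Q \<in> \<Q>. edges Q) \<union>
          {{v, t v} | Q v. Q \<in> \<Q> \<and> v \<in> verts Q \<and> degree Q v = d - 2}"
    "\<forall>i < n. \<forall>v \<in> bay d a i. degree G v \<ge> d - 1"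
    using assms(3) unfolding is_G_def by (elim exE conjE)
  \<comment> \<open>One bay is chosen for each copy.\<close>
  from G(6) obtain home where home:
    "\<forall>Q \<in> \<Q>. home Q < n \<and> (\<forall>v \<in> verts Q. degree Q v = d - 2 \<longrightarrow> t v \<in> bay d a (home Q))"
    by (rule bchoice[THEN exE])
  show thesis
  proof (rule that)
    show "bay_ring d n G a \<Q> t home"
      by unfold_locales (use assms(1,2) G home in \<open>simp_all only:\<close>)
  qed
qed

lemma immersed_imp_clique_immersion:
  assumes "immersed (complete_graph U) G" "finite U"
  shows "\<exists>\<phi> P. clique_immersion G U \<phi> P"
proof -
  obtain \<phi> P where "inj_on \<phi> U" "\<phi> ` U \<subseteq> verts G"
    "\<forall>e \<in> [U]\<^bsup>2\<^esup>. is_path G (P e) \<and> {hd (P e), last (P e)} = \<phi> ` e"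
    "\<forall>e \<in> [U]\<^bsup>2\<^esup>. \<forall>f \<in> [U]\<^bsup>2\<^esup>. e \<noteq> f \<longrightarrow> path_edges (P e) \<inter> path_edges (P f) = {}"
    using assms(1) unfolding immersed_def complete_graph_def by auto
  then have "clique_immersion G U \<phi> P"
    using assms(2) by unfold_locales simp_all
  then show ?thesis by blast
qed

theorem theorem4p12:
  fixes d n :: nat and G :: "'a graph"
  assumes "d \<ge> 8" and "n \<ge> 1" and "is_G d n G"
  shows "min_degree G = d - 1 \<and> \<not> immersed (complete_graph {1..d}) G"
proof -
  obtain a \<Q> t home where "bay_ring d n G a \<Q> t home"
    using is_G_imp_bay_ring[OF assms] by blast
  then interpret bay_ring d n G a \<Q> t home .
  have "\<not> immersed (complete_graph {1..d}) G"
  proof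
    assume "immersed (complete_graph {1..d}) G"
    then obtain \<phi> P where "clique_immersion G {1..d} \<phi> P"
      using immersed_imp_clique_immersion by blast
    then show False
      using no_clique[of "{1..d}"] by simp
  qed
  then show ?thesis
    using min_degree_eq by blast
qed

end
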